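(* Let $X\subseteq\prod_{i\in[r]}\mathbb R^{d_i}$ be a set definable (with parameters) in the structure $\langle\mathbb R,<,+,\mathbb Z\rangle$. Then $Zar(X)$ holds: there is $\alpha\in\mathbb R_{>0}$ such that if $X$ is $k$-free for some $k\ge1$, then $|X\cap B|\le\alpha\,\delta(B)$ for every finite grid $B$.
   Context: $\langle\mathbb R,<,+,\mathbb Z\rangle$ is the ordered additive group of reals expanded by a unary predicate for the integers. Fix positive integers $r,d_1,\dots,d_r$, $[r]=\{1,\dots,r\}$. A grid is a product $B=B_1\times\dots\times B_r$ with $B_i\subseteq\mathbb R^{d_i}$; it is finite if each $B_i$ is finite, a $k$-grid if $|B_i|=k$ for all $i$. $X$ is $k$-free if it contains no $k$-grid. For a finite grid, $\delta(B)=\sum_{1\le i_1<\dots<i_{r-1}\le r}\prod_{j=1}^{r-1}|B_{i_j}|$. *)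

theory Defs
  imports Complex_Main "HOL-Library.FuncSet"
begin

datatype tm = Var nat | Const real | Add tm tm

datatype fm = Less tm tm | Eq tm tm | IsInt tm
  | Neg fm | Conj fm fm | Exi nat fm

primrec tval :: "(nat \<Rightarrow> real) \<Rightarrow> tm \<Rightarrow> real" where
  "tval e (Var n) = e n"
| "tval e (Const c) = c"
| "tval e (Add s t) = tval e s + tval e t"

primrec sat :: "(nat \<Rightarrow> real) \<Rightarrow> fm \<Rightarrow> bool" where
  "sat e (Less s t) = (tval e s < tval e t)"
| "sat e (Eq s t) = (tval e s = tval e t)"
| "sat e (IsInt t) = (tval e t \<in> \<int>)"
| "sat e (Neg p) = (\<not> sat e p)"
| "sat e (Conj p q) = (sat e p \<and> sat e q)"
| "sat e (Exi n p) = (\<exists>a. sat (e(n := a)) p)"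

definition space :: "nat \<Rightarrow> (nat \<Rightarrow> nat) \<Rightarrow> (nat \<Rightarrow> real list) set" where
  "space r d = PiE {1..r} (\<lambda>i. {v. length v = d i})"

definition flat :: "nat \<Rightarrow> (nat \<Rightarrow> real list) \<Rightarrow> real list" where
  "flat r x = concat (map x [1..<Suc r])"

definition total_dim :: "nat \<Rightarrow> (nat \<Rightarrow> nat) \<Rightarrow> nat" where
  "total_dim r d = (\<Sum>i=1..r. d i)"

text \<open>X is definable with parameters in (R,<,+,Z): defined by a formula whose
  variables 0..D-1 are the coordinates (in order) of the point; parameters are constants.\<close>
definition definable :: "nat \<Rightarrow> (nat \<Rightarrow> nat) \<Rightarrow> (nat \<Rightarrow> real list) set \<Rightarrow> bool" where
  "definable r d X \<longleftrightarrow> X \<subseteq> space r d \<and>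
     (\<exists>\<phi>. X = {x \<in> space r d. sat (\<lambda>j. if j < total_dim r d then flat r x ! j else 0) \<phi>})"

definition is_grid :: "nat \<Rightarrow> (nat \<Rightarrow> nat) \<Rightarrow> (nat \<Rightarrow> real list set) \<Rightarrow> bool" where
  "is_grid r d B \<longleftrightarrow> (\<forall>i\<in>{1..r}. B i \<subseteq> {v. length v = d i})"

definition grid_set :: "nat \<Rightarrow> (nat \<Rightarrow> real list set) \<Rightarrow> (nat \<Rightarrow> real list) set" where
  "grid_set r B = PiE {1..r} B"

definition finite_grid :: "nat \<Rightarrow> (nat \<Rightarrow> nat) \<Rightarrow> (nat \<Rightarrow> real list set) \<Rightarrow> bool" where
  "finite_grid r d B \<longleftrightarrow> is_grid r d B \<and> (\<forall>i\<in>{1..r}. finite (B i))"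

definition k_grid :: "nat \<Rightarrow> (nat \<Rightarrow> nat) \<Rightarrow> nat \<Rightarrow> (nat \<Rightarrow> real list set) \<Rightarrow> bool" where
  "k_grid r d k B \<longleftrightarrow> finite_grid r d B \<and> (\<forall>i\<in>{1..r}. card (B i) = k)"

definition k_free :: "nat \<Rightarrow> (nat \<Rightarrow> nat) \<Rightarrow> nat \<Rightarrow> (nat \<Rightarrow> real list) set \<Rightarrow> bool" where
  "k_free r d k X \<longleftrightarrow> \<not> (\<exists>B. k_grid r d k B \<and> grid_set r B \<subseteq> X)"

definition delta :: "nat \<Rightarrow> (nat \<Rightarrow> real list set) \<Rightarrow> nat" where
  "delta r B = (\<Sum>S\<in>{S. S \<subseteq> {1..r} \<and> card S = r - 1}. \<Prod>i\<in>S. card (B i))"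

definition Zar :: "nat \<Rightarrow> (nat \<Rightarrow> nat) \<Rightarrow> (nat \<Rightarrow> real list) set \<Rightarrow> bool" where
  "Zar r d X \<longleftrightarrow> (\<exists>\<alpha>::real. \<alpha> > 0 \<and>
     ((\<exists>k\<ge>1. k_free r d k X) \<longrightarrow>
       (\<forall>B. finite_grid r d B \<longrightarrow> real (card (X \<inter> grid_set r B)) \<le> \<alpha> * real (delta r B))))"

end

theory Submission
  imports Defs "HOL-Decision_Procs.MIR"
begin

text \<open>
  Split every coordinate into its integer and its fractional part. By quantifier elimination for
  the reals with \<open>+\<close>, \<open><\<close>, floor and divisibility, a definable set is a finite union of type classes:
  a type fixes the signs of finitely many integral affine forms \<open>l\<close> on the integer parts \<open>n\<close>, the
  residues of \<open>n\<close> modulo some \<open>M\<close>, and the signs of finitely many real affine forms on the fractional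
  parts. Splitting further into pieces \<open>P\<close>, some of the \<open>l\<close> are constant on \<open>P\<close>, and all the others are
  simultaneously as large as we like in absolute value at suitable points of \<open>P\<close>.

  If a point of \<open>P\<close> is determined by its blocks other than the \<open>i\<close>-th, for some \<open>i\<close>, then \<open>P\<close> meets a
  grid in at most as many points as the product of the other sides. Otherwise, for every \<open>i\<close>
  there are two points of \<open>P\<close> that differ exactly in block \<open>i\<close>; let \<open>v\<^sub>i\<close> and \<open>w\<^sub>i\<close> be the differences of
  their integer and fractional parts. Moving a suitable point of \<open>P\<close> by \<open>\<Sum>i. t\<^sub>i (M v\<^sub>i + \<epsilon> w\<^sub>i)\<close> with
  \<open>t\<^sub>i < k\<close> and \<open>\<epsilon>\<close> small stays inside \<open>P\<close>, so \<open>P\<close> contains a \<open>k\<close>-grid for every \<open>k\<close>.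
\<close>

section \<open>Types of points and piecewise affine functions\<close>

definition affine :: "'c set \<Rightarrow> ('c \<Rightarrow> 'v::comm_ring_1) \<times> 'v \<Rightarrow> ('c \<Rightarrow> 'v) \<Rightarrow> 'v" where
  "affine I f v = snd f + (\<Sum>c\<in>I. fst f c * v c)"

definition int_part :: "(nat \<Rightarrow> real list) \<Rightarrow> nat \<times> nat \<Rightarrow> int" where
  "int_part x c = \<lfloor>x (fst c) ! snd c\<rfloor>"

definition frac_part :: "(nat \<Rightarrow> real list) \<Rightarrow> nat \<times> nat \<Rightarrow> real" where
  "frac_part x c = frac (x (fst c) ! snd c)"

type_synonym 'v form = "(nat \<times> nat \<Rightarrow> 'v) \<times> 'v"

definition same_type ::
    "(nat \<times> nat) set \<Rightarrow> int form set \<Rightarrow> int \<Rightarrow> real form set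
      \<Rightarrow> (nat \<Rightarrow> real list) \<Rightarrow> (nat \<Rightarrow> real list) \<Rightarrow> bool" where
  "same_type I L M G x y \<longleftrightarrow>
     (\<forall>l\<in>L. sgn (affine I l (int_part x)) = sgn (affine I l (int_part y))) \<and>
     (\<forall>c\<in>I. int_part x c mod M = int_part y c mod M) \<and>
     (\<forall>g\<in>G. sgn (affine I g (frac_part x)) = sgn (affine I g (frac_part y)))"

definition type_determined :: "(nat \<times> nat) set \<Rightarrow> ((nat \<Rightarrow> real list) \<Rightarrow> bool) \<Rightarrow> bool" where
  "type_determined I h \<longleftrightarrow> (\<exists>L M G. finite L \<and> M > 0 \<and> finite G \<and>
     (\<forall>x y. same_type I L M G x y \<longrightarrow> h x = h y))"

text \<open>The pair \<open>(l, g)\<close> may depend on the type of \<open>x\<close>, but it comes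
  from a finite set \<open>R\<close>, so finitely many additional forms suffice to treat all pairs
  at once. As \<open>l\<close> is integral, its value at the integer parts is an integer and a floor
  acts on \<open>g\<close> alone.\<close>

definition piecewise_affine :: "(nat \<times> nat) set \<Rightarrow> ((nat \<Rightarrow> real list) \<Rightarrow> real) \<Rightarrow> bool" where
  "piecewise_affine I f \<longleftrightarrow> (\<exists>L M G R. finite L \<and> M > 0 \<and> finite G \<and> finite R \<and>
     (\<forall>x. \<exists>(l, g)\<in>R. \<forall>y. same_type I L M G x y \<longrightarrow>
        f y = of_int (affine I l (int_part y)) + affine I g (frac_part y)))"

lemma same_type_refl: "same_type I L M G x x"
  by (simp add: same_type_def)

lemma same_type_sym: "same_type I L M G x y \<Longrightarrow> same_type I L M G y x"
  by (simp add: same_type_def)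

lemma same_type_mono:
  assumes "same_type I L M G x y" "L' \<subseteq> L" "M' dvd M" "G' \<subseteq> G"
  shows "same_type I L' M' G' x y"
proof -
  have "int_part x c mod M' = int_part y c mod M'" if "c \<in> I" for c
    using assms(1,3) that unfolding same_type_def by (metis mod_mod_cancel)
  then show ?thesis using assms unfolding same_type_def by blast
qed

lemma affine_add:
  "affine I (\<lambda>c. fst f c + fst g c, snd f + snd g) v = affine I f v + affine I g v"
  by (simp add: affine_def algebra_simps sum.distrib)

lemma affine_cmult:
  "affine I (\<lambda>c. k * fst f c, k * snd f) v = k * affine I f v"
  by (simp add: affine_def algebra_simps sum_distrib_left)

lemma affine_shift: "affine I (fst f, snd f + k) v = affine I f v + k"
  by (simp add: affine_def algebra_simps)

lemma affine_zero [simp]: "affine I (\<lambda>c. 0, k) v = k"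
  by (simp add: affine_def)

lemma affine_coordinate:
  assumes "finite I" "c \<in> I"
  shows "affine I (\<lambda>c'. if c' = c then 1 else 0, k) v = v c + k"
proof -
  have "(\<Sum>c'\<in>I. (if c' = c then 1 else 0) * v c') = (\<Sum>c'\<in>I. if c' = c then v c' else 0)"
    by (intro sum.cong) auto
  then show ?thesis using assms by (simp add: affine_def sum.delta)
qed

lemma affine_cong_mod:
  fixes v w :: "'c \<Rightarrow> int"
  assumes "\<And>c. c \<in> I \<Longrightarrow> v c mod M = w c mod M"
  shows "affine I f v mod M = affine I f w mod M"
proof -
  have "M dvd (\<Sum>c\<in>I. fst f c * (v c - w c))"
    using assms by (intro dvd_sum dvd_mult) (simp add: mod_eq_dvd_iff)
  then have "M dvd affine I f v - affine I f w"
    by (simp add: affine_def algebra_simps sum_subtractf)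
  then show ?thesis by (simp add: mod_eq_dvd_iff)
qed

text \<open>Fractional parts lie in [0,1), so a real form takes only finitely many integer values as
  floors there. All finiteness claims about floors rest on this.\<close>

lemma affine_frac_part_bounded:
  "\<bar>affine I g (frac_part x)\<bar> \<le> \<bar>snd g\<bar> + (\<Sum>c\<in>I. \<bar>fst g c\<bar>)"
proof -
  have "\<bar>\<Sum>c\<in>I. fst g c * frac_part x c\<bar> \<le> (\<Sum>c\<in>I. \<bar>fst g c * frac_part x c\<bar>)"
    by (rule sum_abs)
  also have "\<dots> \<le> (\<Sum>c\<in>I. \<bar>fst g c\<bar>)"
  proof (rule sum_mono)
    fix c
    have "\<bar>frac_part x c\<bar> \<le> 1"
      using frac_ge_0[of "x (fst c) ! snd c"] less_imp_le[OF frac_lt_1[of "x (fst c) ! snd c"]]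
      unfolding frac_part_def by linarith
    then show "\<bar>fst g c * frac_part x c\<bar> \<le> \<bar>fst g c\<bar>"
      by (simp add: abs_mult mult_left_le)
  qed
  finally show ?thesis unfolding affine_def by linarith
qed

text \<open>Adding the forms \<open>g - m\<close> for the finitely many integers \<open>m\<close> in the range of \<open>g\<close> on the unit
  cube makes the floor of \<open>g\<close> constant on types.\<close>

definition floor_forms :: "(nat \<times> nat) set \<Rightarrow> real form \<Rightarrow> real form set" where
  "floor_forms I g = (let b = \<lceil>\<bar>snd g\<bar> + (\<Sum>c\<in>I. \<bar>fst g c\<bar>)\<rceil> + 1
     in (\<lambda>m. (fst g, snd g + - real_of_int m)) ` {- b..b})"

lemma finite_floor_forms: "finite (floor_forms I g)"
  by (simp add: floor_forms_def Let_def)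

lemma same_type_floor:
  assumes "same_type I L M G x y" "floor_forms I g \<subseteq> G"
  shows "\<lfloor>affine I g (frac_part x)\<rfloor> = \<lfloor>affine I g (frac_part y)\<rfloor>"
    and "frac (affine I g (frac_part x)) = 0 \<longleftrightarrow> frac (affine I g (frac_part y)) = 0"
proof -
  define b where "b = \<lceil>\<bar>snd g\<bar> + (\<Sum>c\<in>I. \<bar>fst g c\<bar>)\<rceil> + 1"
  define m where "m = \<lfloor>affine I g (frac_part x)\<rfloor>"
  have "\<bar>affine I g (frac_part x)\<bar> \<le> of_int (b - 1)"
    using affine_frac_part_bounded[of I g x] unfolding b_def by linarith
  \<comment> \<open>The extra 1 in \<open>b\<close> makes room for \<open>m + 1\<close> as well as
    \<open>m\<close>. The signs of the form minus \<open>m\<close> and minus \<open>m + 1\<close>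
    then confine its value to [m, m + 1).\<close>
  then have m: "m \<in> {- b..b}" "m + 1 \<in> {- b..b}" unfolding m_def by (auto; linarith)+
  have sg: "sgn (affine I g (frac_part x) - k) = sgn (affine I g (frac_part y) - k)"
    if "k \<in> {- b..b}" for k :: int
  proof -
    have "(fst g, snd g + - real_of_int k) \<in> G"
      using assms(2) that unfolding floor_forms_def Let_def b_def[symmetric] by blast
    then have "sgn (affine I (fst g, snd g + - real_of_int k) (frac_part x)) =
        sgn (affine I (fst g, snd g + - real_of_int k) (frac_part y))"
      using assms(1) unfolding same_type_def by blast
    then show ?thesis unfolding affine_shift by simp
  qed
  have a: "m \<le> affine I g (frac_part x)" "affine I g (frac_part x) < m + 1"
    unfolding m_def by linarith+
  have b: "m \<le> affine I g (frac_part y)" "affine I g (frac_part y) < m + 1"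
    using a sg[OF m(1)] sg[OF m(2)] by (auto simp: sgn_if split: if_splits)
  show eq: "\<lfloor>affine I g (frac_part x)\<rfloor> = \<lfloor>affine I g (frac_part y)\<rfloor>"
    using b unfolding m_def[symmetric] by linarith
  show "frac (affine I g (frac_part x)) = 0 \<longleftrightarrow> frac (affine I g (frac_part y)) = 0"
    using sg[OF m(1)] unfolding frac_def eq[symmetric] m_def[symmetric]
    by (metis sgn_eq_0_iff)
qed

text \<open>These are the integral forms that can occur as the floor of \<open>l\<close> plus
  \<open>g\<close>, one for each floor that \<open>g\<close> attains on fractional parts.\<close>

definition shifted_by_floor :: "(nat \<times> nat) set \<Rightarrow> int form \<Rightarrow> real form \<Rightarrow> int form set" where
  "shifted_by_floor I l g = range (\<lambda>x. (fst l, snd l + \<lfloor>affine I g (frac_part x)\<rfloor>))"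

lemma finite_shifted_by_floor: "finite (shifted_by_floor I l g)"
proof (rule finite_subset)
  define b where "b = \<lceil>\<bar>snd g\<bar> + (\<Sum>c\<in>I. \<bar>fst g c\<bar>)\<rceil> + 1"
  have "\<lfloor>affine I g (frac_part x)\<rfloor> \<in> {- b..b}" for x
    using affine_frac_part_bounded[of I g x] unfolding b_def atLeastAtMost_iff by linarith
  then show "shifted_by_floor I l g \<subseteq> (\<lambda>m. (fst l, snd l + m)) ` {- b..b}"
    unfolding shifted_by_floor_def by blast
qed simp

section \<open>Closure properties of piecewise affine functions\<close>

lemma piecewise_affine_int_plus_affine:
  "piecewise_affine I (\<lambda>x. of_int (affine I l (int_part x)) + affine I g (frac_part x))"
  unfolding piecewise_affine_def
  by (intro exI[of _ "{}"] exI[of _ 1] exI[of _ "{(l, g)}"]) simp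

lemma piecewise_affine_const: "piecewise_affine I (\<lambda>x. k)"
  using piecewise_affine_int_plus_affine[of I "(\<lambda>_. 0, 0)" "(\<lambda>_. 0, k)"] by simp

lemma piecewise_affine_coordinate:
  assumes "finite I" "c \<in> I"
  shows "piecewise_affine I (\<lambda>x. x (fst c) ! snd c)"
  using piecewise_affine_int_plus_affine[of I "(\<lambda>c'. if c' = c then 1 else 0, 0)"
      "(\<lambda>c'. if c' = c then 1 else 0, 0)"]
  by (simp add: affine_coordinate[OF assms] int_part_def frac_part_def frac_def)

lemma piecewise_affine_add:
  assumes "piecewise_affine I f1" "piecewise_affine I f2"
  shows "piecewise_affine I (\<lambda>x. f1 x + f2 x)"
proof -
  obtain L1 M1 G1 R1 where 1: "finite L1" "M1 > 0" "finite G1" "finite R1"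
    "\<And>x. \<exists>(l, g)\<in>R1. \<forall>y. same_type I L1 M1 G1 x y \<longrightarrow>
        f1 y = of_int (affine I l (int_part y)) + affine I g (frac_part y)"
    using assms(1) unfolding piecewise_affine_def by blast
  obtain L2 M2 G2 R2 where 2: "finite L2" "M2 > 0" "finite G2" "finite R2"
    "\<And>x. \<exists>(l, g)\<in>R2. \<forall>y. same_type I L2 M2 G2 x y \<longrightarrow>
        f2 y = of_int (affine I l (int_part y)) + affine I g (frac_part y)"
    using assms(2) unfolding piecewise_affine_def by blast
  define plus where "plus = (\<lambda>((l1 :: int form, g1 :: real form), (l2 :: int form, g2 :: real form)).
    ((\<lambda>c. fst l1 c + fst l2 c, snd l1 + snd l2), (\<lambda>c. fst g1 c + fst g2 c, snd g1 + snd g2)))"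
  have "\<exists>(l, g)\<in>plus ` (R1 \<times> R2). \<forall>y. same_type I (L1 \<union> L2) (M1 * M2) (G1 \<union> G2) x y \<longrightarrow>
        f1 y + f2 y = of_int (affine I l (int_part y)) + affine I g (frac_part y)" for x
  proof -
    obtain l1 g1 where f1: "(l1, g1) \<in> R1" "\<And>y. same_type I L1 M1 G1 x y \<Longrightarrow>
        f1 y = of_int (affine I l1 (int_part y)) + affine I g1 (frac_part y)"
      using 1(5) by blast
    obtain l2 g2 where f2: "(l2, g2) \<in> R2" "\<And>y. same_type I L2 M2 G2 x y \<Longrightarrow>
        f2 y = of_int (affine I l2 (int_part y)) + affine I g2 (frac_part y)"
      using 2(5) by blast
    have "f1 y + f2 y = of_int (affine I (\<lambda>c. fst l1 c + fst l2 c, snd l1 + snd l2) (int_part y))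
        + affine I (\<lambda>c. fst g1 c + fst g2 c, snd g1 + snd g2) (frac_part y)"
      if "same_type I (L1 \<union> L2) (M1 * M2) (G1 \<union> G2) x y" for y
      using f1(2)[OF same_type_mono[OF that]] f2(2)[OF same_type_mono[OF that]]
      by (simp add: affine_add)
    moreover have "plus ((l1, g1), (l2, g2)) \<in> plus ` (R1 \<times> R2)" using f1(1) f2(1) by blast
    ultimately show ?thesis by (intro bexI[of _ "plus ((l1, g1), (l2, g2))"]) (auto simp: plus_def)
  qed
  moreover have "finite (plus ` (R1 \<times> R2))" using 1(4) 2(4) by blast
  ultimately show ?thesis unfolding piecewise_affine_def using 1(1-3) 2(1-3)
    by (intro exI[of _ "L1 \<union> L2"] exI[of _ "M1 * M2"] exI[of _ "G1 \<union> G2"]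
        exI[of _ "plus ` (R1 \<times> R2)"]) simp
qed

text \<open>The factor is an integer so that the scaled form \<open>l\<close> keeps integer
  coefficients.\<close>

lemma piecewise_affine_cmult:
  assumes "piecewise_affine I f"
  shows "piecewise_affine I (\<lambda>x. of_int k * f x)"
proof -
  obtain L M G R where 1: "finite L" "M > 0" "finite G" "finite R"
    "\<And>x. \<exists>(l, g)\<in>R. \<forall>y. same_type I L M G x y \<longrightarrow>
        f y = of_int (affine I l (int_part y)) + affine I g (frac_part y)"
    using assms unfolding piecewise_affine_def by blast
  define scale where "scale = (\<lambda>(l :: int form, g :: real form).
    ((\<lambda>c. k * fst l c, k * snd l), (\<lambda>c. of_int k * fst g c, of_int k * snd g)))"
  have "\<exists>(l, g)\<in>scale ` R. \<forall>y. same_type I L M G x y \<longrightarrow>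
        of_int k * f y = of_int (affine I l (int_part y)) + affine I g (frac_part y)" for x
  proof -
    obtain l g where f: "(l, g) \<in> R" "\<And>y. same_type I L M G x y \<Longrightarrow>
        f y = of_int (affine I l (int_part y)) + affine I g (frac_part y)"
      using 1(5) by blast
    have "scale (l, g) \<in> scale ` R" using f(1) by blast
    then show ?thesis
      by (intro bexI[of _ "scale (l, g)"])
        (auto simp: scale_def affine_cmult f(2) distrib_left)
  qed
  moreover have "finite (scale ` R)" using 1(4) by blast
  ultimately show ?thesis unfolding piecewise_affine_def using 1(1-3) by blast
qed

text \<open>The floor of an integer plus \<open>g\<close> is that integer plus the floor of
  \<open>g\<close>. After refining by \<open>floor_forms\<close>, the floor of \<open>g\<close> is
  constant on each type and is absorbed into the constant term of \<open>l\<close>, leaving the zero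
  form as real part.\<close>

lemma piecewise_affine_floor:
  assumes "piecewise_affine I f"
  shows "piecewise_affine I (\<lambda>x. of_int \<lfloor>f x\<rfloor>)"
proof -
  obtain L M G R where 1: "finite L" "M > 0" "finite G" "finite R"
    "\<And>x. \<exists>(l, g)\<in>R. \<forall>y. same_type I L M G x y \<longrightarrow>
        f y = of_int (affine I l (int_part y)) + affine I g (frac_part y)"
    using assms unfolding piecewise_affine_def by blast
  define G' where "G' = G \<union> (\<Union>(l, g)\<in>R. floor_forms I g)"
  define R' where "R' = (\<Union>(l, g)\<in>R. shifted_by_floor I l g) \<times> {(\<lambda>_. 0, 0) :: real form}"
  have fin: "finite G'" unfolding G'_def using 1 by (auto simp: finite_floor_forms)
  have finR: "finite R'" unfolding R'_def using 1(4) finite_shifted_by_floor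
    by (auto simp: case_prod_beta)
  have "\<exists>(l, g)\<in>R'. \<forall>y. same_type I L M G' x y \<longrightarrow>
        of_int \<lfloor>f y\<rfloor> = of_int (affine I l (int_part y)) + affine I g (frac_part y)" for x
  proof -
    obtain l g where f: "(l, g) \<in> R" "\<And>y. same_type I L M G x y \<Longrightarrow>
        f y = of_int (affine I l (int_part y)) + affine I g (frac_part y)"
      using 1(5) by blast
    define l' where "l' = (fst l, snd l + \<lfloor>affine I g (frac_part x)\<rfloor>)"
    have mem: "(l', (\<lambda>_. 0, 0)) \<in> R'" unfolding R'_def l'_def shifted_by_floor_def using f(1) by blast
    have "of_int \<lfloor>f y\<rfloor> = of_int (affine I l' (int_part y)) + affine I (\<lambda>_. 0, 0 :: real) (frac_part y)"
      if s: "same_type I L M G' x y" for y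
    proof -
      have "floor_forms I g \<subseteq> G'" unfolding G'_def using f(1) by blast
      then have "\<lfloor>affine I g (frac_part x)\<rfloor> = \<lfloor>affine I g (frac_part y)\<rfloor>"
        using same_type_floor(1)[OF s] by blast
      moreover have "same_type I L M G x y" using same_type_mono[OF s] unfolding G'_def by simp
      ultimately show ?thesis unfolding l'_def affine_shift using f(2) by simp
    qed
    with mem show ?thesis by blast
  qed
  then show ?thesis unfolding piecewise_affine_def using 1(1,2) fin finR by blast
qed

section \<open>Conditions decided by the type of a point\<close>

lemma type_determined_not: "type_determined I h \<Longrightarrow> type_determined I (\<lambda>x. \<not> h x)"
  unfolding type_determined_def by metis

lemma type_determined_const: "type_determined I (\<lambda>x. b)"
  unfolding type_determined_def by (intro exI[of _ "{}"] exI[of _ 1]) simp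

lemma type_determined_binop:
  assumes "type_determined I h1" "type_determined I h2"
  shows "type_determined I (\<lambda>x. b (h1 x) (h2 x))"
proof -
  obtain L1 M1 G1 where 1: "finite L1" "M1 > 0" "finite G1"
    "\<And>x y. same_type I L1 M1 G1 x y \<Longrightarrow> h1 x = h1 y"
    using assms(1) unfolding type_determined_def by blast
  obtain L2 M2 G2 where 2: "finite L2" "M2 > 0" "finite G2"
    "\<And>x y. same_type I L2 M2 G2 x y \<Longrightarrow> h2 x = h2 y"
    using assms(2) unfolding type_determined_def by blast
  have "b (h1 x) (h2 x) = b (h1 y) (h2 y)"
    if "same_type I (L1 \<union> L2) (M1 * M2) (G1 \<union> G2) x y" for x y
    using 1(4)[OF same_type_mono[OF that]] 2(4)[OF same_type_mono[OF that]] by simp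
  then show ?thesis unfolding type_determined_def using 1(1-3) 2(1-3)
    by (intro exI[of _ "L1 \<union> L2"] exI[of _ "M1 * M2"] exI[of _ "G1 \<union> G2"]) simp
qed

text \<open>On a refined type \<open>f\<close> is \<open>l + g\<close>, where \<open>g\<close> has a
  constant floor \<open>m\<close>. So the floor of \<open>f\<close> is the integral form
  \<open>l + m\<close>, whose sign and residues the type records, and \<open>f\<close> is an integer
  exactly when \<open>g = m\<close>, which the type also decides. Floor and integrality together
  give the sign of \<open>f\<close> and its divisibility.\<close>

lemma type_determined_atoms:
  assumes "piecewise_affine I f"
  shows type_determined_sgn: "type_determined I (\<lambda>x. sgn (f x) = s)"
    and type_determined_rdvd: "type_determined I (\<lambda>x. of_int i rdvd f x)"
proof -
  obtain L M G R where 1: "finite L" "M > 0" "finite G" "finite R"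
    "\<And>x. \<exists>(l, g)\<in>R. \<forall>y. same_type I L M G x y \<longrightarrow>
        f y = of_int (affine I l (int_part y)) + affine I g (frac_part y)"
    using assms unfolding piecewise_affine_def by blast
  define L' where "L' = L \<union> (\<Union>(l, g)\<in>R. shifted_by_floor I l g)"
  define G' where "G' = G \<union> (\<Union>(l, g)\<in>R. floor_forms I g)"
  \<comment> \<open>Divisibility by 0 means \<open>f x = 0\<close> and calls for no new residues;
    otherwise the modulus is made a multiple of \<open>i\<close>.\<close>
  define M' where "M' = (if i = 0 then M else M * \<bar>i\<bar>)"
  have finG: "finite G'" unfolding G'_def using 1 by (auto simp: finite_floor_forms)
  have finL: "finite L'" unfolding L'_def using 1(1,4) finite_shifted_by_floor by (auto simp: case_prod_beta)
  have M': "M' > 0" "M dvd M'" unfolding M'_def using 1(2) by auto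
  have key: "sgn (f x) = sgn (f y)" "of_int i rdvd f x \<longleftrightarrow> of_int i rdvd f y"
    if s: "same_type I L' M' G' x y" for x y
  proof -
    obtain l g where f: "(l, g) \<in> R" "\<And>y. same_type I L M G x y \<Longrightarrow>
        f y = of_int (affine I l (int_part y)) + affine I g (frac_part y)"
      using 1(5) by blast
    have s': "same_type I L M G x y"
      using same_type_mono[OF s _ M'(2)] unfolding G'_def L'_def by simp
    note fx = f(2)[OF same_type_refl] and fy = f(2)[OF s']
    define m where "m = \<lfloor>affine I g (frac_part x)\<rfloor>"
    have sub: "floor_forms I g \<subseteq> G'" unfolding G'_def using f(1) by blast
    have my: "\<lfloor>affine I g (frac_part y)\<rfloor> = m" using same_type_floor(1)[OF s sub] m_def by simp
    have z: "affine I g (frac_part x) = m \<longleftrightarrow> affine I g (frac_part y) = m"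
      using same_type_floor(2)[OF s sub] by (simp add: frac_def my m_def[symmetric])
    have "(fst l, snd l + m) \<in> L'" unfolding L'_def m_def shifted_by_floor_def using f(1) by blast
    then have sl: "sgn (affine I l (int_part x) + m) = sgn (affine I l (int_part y) + m)"
      using s unfolding same_type_def by (metis affine_shift)
    have flx: "\<lfloor>f x\<rfloor> = affine I l (int_part x) + m" unfolding fx m_def by simp
    have fly: "\<lfloor>f y\<rfloor> = affine I l (int_part y) + m" unfolding fy my[symmetric] by simp
    have intx: "of_int \<lfloor>f x\<rfloor> = f x \<longleftrightarrow> affine I g (frac_part x) = m"
      using fx flx by (simp only: of_int_add) (rule iffI; linarith)
    have inty: "of_int \<lfloor>f y\<rfloor> = f y \<longleftrightarrow> affine I g (frac_part y) = m"
      using fy fly by (simp only: of_int_add) (rule iffI; linarith)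
    have "f x < 0 \<longleftrightarrow> f y < 0" using sl unfolding flx[symmetric] fly[symmetric]
      by (metis floor_less_zero sgn_less)
    moreover have zero: "f x = 0 \<longleftrightarrow> f y = 0"
      using sl z intx inty unfolding flx[symmetric] fly[symmetric]
      by (metis floor_zero of_int_0 sgn_eq_0_iff)
    ultimately show "sgn (f x) = sgn (f y)" by (auto simp: sgn_if)
    show "of_int i rdvd f x \<longleftrightarrow> of_int i rdvd f y"
    proof (cases "i = 0")
      case True
      then show ?thesis using zero by (simp add: rdvd_def)
    next
      case False
      then have "i dvd M'" unfolding M'_def by simp
      then have "same_type I L' i G' x y" using same_type_mono[OF s] by blast
      then have "affine I l (int_part x) mod i = affine I l (int_part y) mod i"
        by (intro affine_cong_mod) (simp add: same_type_def)
      then have "\<lfloor>f x\<rfloor> mod i = \<lfloor>f y\<rfloor> mod i" unfolding flx fly by (metis mod_add_left_eq)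
      then have "i dvd \<lfloor>f x\<rfloor> \<longleftrightarrow> i dvd \<lfloor>f y\<rfloor>" by (simp add: dvd_eq_mod_eq_0)
      then show ?thesis unfolding int_rdvd_real using z intx inty by simp
    qed
  qed
  show "type_determined I (\<lambda>x. sgn (f x) = s)" "type_determined I (\<lambda>x. of_int i rdvd f x)"
    unfolding type_determined_def using key finL finG M'(1) by metis+
qed

section \<open>Grid bounds\<close>

text \<open>Induction on the number of functions not yet held constant. Either those are
  simultaneously unbounded on the piece, which is the case \<open>nice\<close>, or for some
  \<open>K\<close> every point has one of them with value at most \<open>K\<close>. In the latter
  case the piece is the union of finitely many pieces on which one more function is
  constant.\<close>

lemma constant_or_unbounded_split:
  fixes f :: "'b \<Rightarrow> 'a \<Rightarrow> nat"
  assumes fin: "finite L"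
    and emp: "Q {}" and un: "\<And>U V. Q U \<Longrightarrow> Q V \<Longrightarrow> Q (U \<union> V)"
    and nice: "\<And>J c P. \<lbrakk>J \<subseteq> L; P = {x\<in>S. \<forall>j\<in>J. f j x = c j};
      \<And>K. \<exists>x\<in>P. \<forall>j\<in>L - J. f j x > K\<rbrakk> \<Longrightarrow> Q P"
  shows "Q S"
proof -
  have Un: "Q (\<Union>p\<in>I. U p)" if "finite I" "\<And>p. p \<in> I \<Longrightarrow> Q (U p)" for I :: "('b \<times> nat) set" and U
    using that by (induction I) (auto intro: emp un)
  have "Q {x\<in>S. \<forall>j\<in>J. f j x = c j}" if "J \<subseteq> L" for J c
    using that
  proof (induction "card (L - J)" arbitrary: J c rule: less_induct)
    case less
    let ?P = "{x\<in>S. \<forall>j\<in>J. f j x = c j}"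
    show ?case
    proof (cases "\<forall>K. \<exists>x\<in>?P. \<forall>j\<in>L - J. f j x > K")
      case True
      then show ?thesis by (intro nice[OF less.prems refl]) (rule spec)
    next
      case False
      then obtain K where nK: "\<not> (\<exists>x\<in>?P. \<forall>j\<in>L - J. f j x > K)" by blast
      have K: "\<exists>j\<in>L - J. f j x \<le> K" if "x \<in> ?P" for x
      proof (rule ccontr)
        assume "\<not> (\<exists>j\<in>L - J. f j x \<le> K)"
        then have "\<forall>j\<in>L - J. f j x > K" by (simp add: not_le)
        then have "\<exists>x\<in>?P. \<forall>j\<in>L - J. f j x > K" using that by (rule bexI)
        with nK show False by (rule notE)
      qed
      let ?I = "(L - J) \<times> {..K}"
      let ?U = "\<lambda>p. {x\<in>S. \<forall>j\<in>insert (fst p) J. f j x = (c(fst p := snd p)) j}"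
      have "Q (?U p)" if "p \<in> ?I" for p
      proof (rule less.hyps[of "insert (fst p) J" "c(fst p := snd p)"])
        have p: "fst p \<in> L" "fst p \<notin> J" using that by auto
        then have "L - insert (fst p) J \<subset> L - J" by blast
        then show "card (L - insert (fst p) J) < card (L - J)"
          using fin by (intro psubset_card_mono) simp_all
        show "insert (fst p) J \<subseteq> L" using p less.prems by simp
      qed
      then have "Q (\<Union>p\<in>?I. ?U p)" using fin by (intro Un[of ?I ?U]) simp_all
      moreover have "(\<Union>p\<in>?I. ?U p) = ?P"
      proof (intro equalityI subsetI)
        fix x assume x: "x \<in> ?P"
        then obtain j where "j \<in> L - J" "f j x \<le> K" using K by blast
        then show "x \<in> (\<Union>p\<in>?I. ?U p)" using x by (intro UN_I[of "(j, f j x)"]) auto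
      next
        fix x assume "x \<in> (\<Union>p\<in>?I. ?U p)"
        then obtain p where p: "p \<in> ?I" "x \<in> ?U p" by blast
        have "f j x = c j" if "j \<in> J" for j
        proof -
          have "j \<noteq> fst p" using p(1) that by auto
          then show ?thesis using p(2) that by simp
        qed
        then show "x \<in> ?P" using p(2) by simp
      qed
      ultimately show ?thesis by simp
    qed
  qed
  from this[of "{}"] show ?thesis by simp
qed

text \<open>The conclusion of \<open>Zar\<close> separated from freeness, so that it passes to
  finite unions by adding the constants.\<close>

definition grid_bounded :: "nat \<Rightarrow> (nat \<Rightarrow> nat) \<Rightarrow> (nat \<Rightarrow> real list) set \<Rightarrow> bool" where
  "grid_bounded r d S \<longleftrightarrow> (\<exists>a\<ge>0. \<forall>B. finite_grid r d B \<longrightarrow>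
     real (card (S \<inter> grid_set r B)) \<le> a * real (delta r B))"

lemma grid_bounded_empty: "grid_bounded r d {}"
  unfolding grid_bounded_def by (intro exI[of _ 0]) simp

lemma grid_bounded_Un:
  assumes "grid_bounded r d S" "grid_bounded r d S'"
  shows "grid_bounded r d (S \<union> S')"
proof -
  obtain a b where ab: "a \<ge> 0" "b \<ge> 0"
    "\<And>B. finite_grid r d B \<Longrightarrow> real (card (S \<inter> grid_set r B)) \<le> a * real (delta r B)"
    "\<And>B. finite_grid r d B \<Longrightarrow> real (card (S' \<inter> grid_set r B)) \<le> b * real (delta r B)"
    using assms unfolding grid_bounded_def by blast
  have "real (card ((S \<union> S') \<inter> grid_set r B)) \<le> (a + b) * real (delta r B)"
    if "finite_grid r d B" for B
  proof -
    have "card ((S \<union> S') \<inter> grid_set r B) \<le> card (S \<inter> grid_set r B) + card (S' \<inter> grid_set r B)"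
      unfolding Int_Un_distrib2 by (rule card_Un_le)
    then show ?thesis using ab(3,4)[OF that] by (simp add: distrib_right)
  qed
  then show ?thesis unfolding grid_bounded_def using ab(1,2)
    by (intro exI[of _ "a + b"]) auto
qed

lemma grid_bounded_Union:
  assumes "finite \<S>" "\<And>S. S \<in> \<S> \<Longrightarrow> grid_bounded r d S"
  shows "grid_bounded r d (\<Union>\<S>)"
  using assms by (induction \<S>) (auto intro: grid_bounded_empty grid_bounded_Un)

text \<open>Deleting block \<open>i\<close> is injective on \<open>S\<close>, so the count is at
  most the product of the other sides, which is one summand of \<open>delta\<close>.\<close>

lemma grid_bounded_if_block_determined:
  assumes i: "i \<in> {1..r}"
    and inj: "\<And>x y. x \<in> S \<Longrightarrow> y \<in> S \<Longrightarrow> \<forall>j\<in>{1..r} - {i}. x j = y j \<Longrightarrow> x = y"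
  shows "grid_bounded r d S"
  unfolding grid_bounded_def
proof (intro exI[of _ 1] conjI allI impI)
  fix B assume B: "finite_grid r d B"
  let ?D = "{1..r} - {i}"
  have fin: "finite (B j)" if "j \<in> {1..r}" for j using B that unfolding finite_grid_def by blast
  have "card (S \<inter> grid_set r B) \<le> card (PiE ?D B)"
  proof (rule card_inj_on_le[of "\<lambda>x. restrict x ?D"])
    show "inj_on (\<lambda>x. restrict x ?D) (S \<inter> grid_set r B)"
      by (intro inj_onI inj) (auto simp: restrict_def fun_eq_iff split: if_splits)
    show "(\<lambda>x. restrict x ?D) ` (S \<inter> grid_set r B) \<subseteq> PiE ?D B"
    proof
      fix y assume "y \<in> (\<lambda>x. restrict x ?D) ` (S \<inter> grid_set r B)"
      then obtain x where "x \<in> grid_set r B" "y = restrict x ?D" by blast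
      then show "y \<in> PiE ?D B" unfolding grid_set_def PiE_iff by simp
    qed
    show "finite (PiE ?D B)" by (intro finite_PiE) (auto intro: fin)
  qed
  also have "\<dots> = (\<Prod>j\<in>?D. card (B j))" by (simp add: card_PiE)
  also have "\<dots> \<le> delta r B"
    unfolding delta_def
  proof (rule member_le_sum)
    show "?D \<in> {S. S \<subseteq> {1..r} \<and> card S = r - 1}" using i by auto
    show "finite {S. S \<subseteq> {1..r} \<and> card S = r - 1}"
      by (rule finite_subset[of _ "Pow {1..r}"]) auto
  qed simp
  finally show "real (card (S \<inter> grid_set r B)) \<le> 1 * real (delta r B)" by simp
qed simp

section \<open>Affine forms under blockwise translations\<close>

definition coords :: "nat \<Rightarrow> (nat \<Rightarrow> nat) \<Rightarrow> (nat \<times> nat) set" where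
  "coords r d = Sigma {1..r} (\<lambda>i. {..<d i})"

lemma finite_coords: "finite (coords r d)"
  by (simp add: coords_def)

text \<open>The change of the form \<open>f\<close> when block \<open>i\<close> alone is translated
  by \<open>v\<close>.\<close>

definition slope :: "(nat \<Rightarrow> nat) \<Rightarrow> 'v form \<Rightarrow> (nat \<times> nat \<Rightarrow> 'v::comm_ring_1) \<Rightarrow> nat \<Rightarrow> 'v" where
  "slope d f v i = (\<Sum>q<d i. fst f (i, q) * v (i, q))"

lemma affine_shift_blocks:
  "affine (coords r d) f (\<lambda>c. p c + t (fst c) * v c) =
     affine (coords r d) f p + (\<Sum>i\<in>{1..r}. t i * slope d f v i)"
proof -
  have "(\<Sum>c\<in>coords r d. fst f c * (t (fst c) * v c)) =
      (\<Sum>i\<in>{1..r}. \<Sum>q<d i. fst f (i, q) * (t i * v (i, q)))"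
    unfolding coords_def by (subst sum.Sigma) (auto simp: case_prod_beta)
  also have "\<dots> = (\<Sum>i\<in>{1..r}. t i * slope d f v i)"
    by (simp add: slope_def sum_distrib_left mult.left_commute)
  finally show ?thesis by (simp add: affine_def distrib_left sum.distrib)
qed

text \<open>All terms outside block \<open>i\<close> cancel, so slopes can be read off from two
  points that differ in that block only.\<close>

lemma affine_diff_block:
  assumes "i \<in> {1..r}" "\<And>c. c \<in> coords r d \<Longrightarrow> fst c \<noteq> i \<Longrightarrow> p c = p' c"
    and "\<And>q. q < d i \<Longrightarrow> v (i, q) = p (i, q) - p' (i, q)"
  shows "affine (coords r d) f p - affine (coords r d) f p' = slope d f v i"
proof -
  have "affine (coords r d) f p - affine (coords r d) f p' =
      (\<Sum>c\<in>coords r d. fst f c * (p c - p' c))"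
    by (simp add: affine_def algebra_simps sum_subtractf)
  also have "\<dots> = (\<Sum>c\<in>Pair i ` {..<d i}. fst f c * (p c - p' c))"
  proof (rule sum.mono_neutral_right)
    show "\<forall>c\<in>coords r d - Pair i ` {..<d i}. fst f c * (p c - p' c) = 0"
    proof
      fix c assume c: "c \<in> coords r d - Pair i ` {..<d i}"
      then have "fst c \<noteq> i" by (cases c) (auto simp: coords_def)
      then show "fst f c * (p c - p' c) = 0" using assms(2) c by simp
    qed
  qed (use assms(1) in \<open>auto simp: coords_def\<close>)
  also have "\<dots> = slope d f v i"
    using assms(3) by (simp add: sum.reindex inj_on_def slope_def)
  finally show ?thesis .
qed

lemma sgn_add_small:
  fixes a b :: "'a::linordered_idom"
  assumes "\<bar>b\<bar> < \<bar>a\<bar>"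
  shows "sgn (a + b) = sgn a"
  using assms by (auto simp: sgn_if abs_if split: if_splits)

lemma abs_sum_mult_le:
  fixes t s :: "'b \<Rightarrow> 'a::linordered_idom"
  assumes "\<And>i. i \<in> I \<Longrightarrow> \<bar>t i\<bar> \<le> k"
  shows "\<bar>\<Sum>i\<in>I. t i * s i\<bar> \<le> k * (\<Sum>i\<in>I. \<bar>s i\<bar>)"
proof -
  have "\<bar>\<Sum>i\<in>I. t i * s i\<bar> \<le> (\<Sum>i\<in>I. \<bar>t i * s i\<bar>)" by (rule sum_abs)
  also have "\<dots> \<le> (\<Sum>i\<in>I. k * \<bar>s i\<bar>)"
    using assms by (intro sum_mono) (simp add: abs_mult mult_right_mono)
  finally show ?thesis by (simp add: sum_distrib_left)
qed

text \<open>Either no block moves the form, or the whole translation changes it by less than its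
  absolute value. The second alternative is used twice: for integral forms because their values can
  be made large, and for real forms because the step can be made small.\<close>

lemma sgn_affine_shift_blocks:
  fixes p v :: "nat \<times> nat \<Rightarrow> 'v::linordered_idom"
  assumes t: "\<And>i. i \<in> {1..r} \<Longrightarrow> \<bar>t i\<bar> \<le> k"
    and zero_or_big: "(\<forall>i\<in>{1..r}. slope d f v i = 0) \<or>
      k * (\<Sum>i\<in>{1..r}. \<bar>slope d f v i\<bar>) < \<bar>affine (coords r d) f p\<bar>"
  shows "sgn (affine (coords r d) f (\<lambda>c. p c + t (fst c) * v c)) = sgn (affine (coords r d) f p)"
  using zero_or_big
proof
  assume "\<forall>i\<in>{1..r}. slope d f v i = 0"
  then show ?thesis unfolding affine_shift_blocks by simp
next
  assume "k * (\<Sum>i\<in>{1..r}. \<bar>slope d f v i\<bar>) < \<bar>affine (coords r d) f p\<bar>"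
  then have "\<bar>\<Sum>i\<in>{1..r}. t i * slope d f v i\<bar> < \<bar>affine (coords r d) f p\<bar>"
    using abs_sum_mult_le[of "{1..r}" t k, OF t] by (rule le_less_trans[rotated])
  then show ?thesis unfolding affine_shift_blocks by (rule sgn_add_small)
qed

section \<open>Grids inside type classes\<close>

lemma same_type_trans:
  "same_type I L M G x y \<Longrightarrow> same_type I L M G y z \<Longrightarrow> same_type I L M G x z"
  by (simp add: same_type_def)

lemma grid_in_type_class:
  assumes I: "I = coords r d" and fin: "finite L" "finite G" and M: "M > 0"
    and G: "\<And>c. c \<in> I \<Longrightarrow> (\<lambda>c'. if c' = c then 1 else 0, 0) \<in> G"
    and J: "J \<subseteq> L"
    and P: "P = {x\<in>space r d. same_type I L M G s x \<and>
      (\<forall>l\<in>J. nat \<bar>affine I l (int_part x)\<bar> = b l)}"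
    and unb: "\<And>K. \<exists>x\<in>P. \<forall>l\<in>L - J. nat \<bar>affine I l (int_part x)\<bar> > K"
    and fibres: "\<And>i. i \<in> {1..r} \<Longrightarrow> \<exists>x\<in>P. \<exists>y\<in>P. (\<forall>j\<in>{1..r} - {i}. x j = y j) \<and> x \<noteq> y"
  shows "\<exists>B. k_grid r d k B \<and> grid_set r B \<subseteq> P"
proof -
  have finI: "finite I" unfolding I by (rule finite_coords)
  obtain X Y where XY: "\<And>i. i \<in> {1..r} \<Longrightarrow> X i \<in> P" "\<And>i. i \<in> {1..r} \<Longrightarrow> Y i \<in> P"
    "\<And>i j. i \<in> {1..r} \<Longrightarrow> j \<in> {1..r} \<Longrightarrow> j \<noteq> i \<Longrightarrow> X i j = Y i j"
    "\<And>i. i \<in> {1..r} \<Longrightarrow> X i \<noteq> Y i"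
    using fibres by (metis DiffI empty_iff insert_iff)
  \<comment> \<open>One vector holds the directions of all blocks: each coordinate takes its
    difference from the pair of points belonging to its own block.\<close>
  define v where "v c = int_part (X (fst c)) c - int_part (Y (fst c)) c" for c
  define w where "w c = frac_part (X (fst c)) c - frac_part (Y (fst c)) c" for c
  have same: "same_type I L M G x y" if "x \<in> P" "y \<in> P" for x y
    using that unfolding P by (blast intro: same_type_trans same_type_sym)
  have slope_v: "affine I l (int_part (X i)) - affine I l (int_part (Y i)) = slope d l v i"
    if i: "i \<in> {1..r}" for i l
    unfolding I
  proof (rule affine_diff_block[OF i])
    fix c assume "c \<in> coords r d" "fst c \<noteq> i"
    then show "int_part (X i) c = int_part (Y i) c"
      using XY(3)[OF i, of "fst c"] by (auto simp: coords_def int_part_def)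
  qed (simp add: v_def)
  have slope_w: "affine I g (frac_part (X i)) - affine I g (frac_part (Y i)) = slope d g w i"
    if i: "i \<in> {1..r}" for i g
    unfolding I
  proof (rule affine_diff_block[OF i])
    fix c assume "c \<in> coords r d" "fst c \<noteq> i"
    then show "frac_part (X i) c = frac_part (Y i) c"
      using XY(3)[OF i, of "fst c"] by (auto simp: coords_def frac_part_def)
  qed (simp add: w_def)
  \<comment> \<open>On \<open>P\<close> the absolute value of a form in \<open>J\<close> is fixed by
    \<open>b\<close> and its sign by the type, so it has the same value at both points of each
    pair.\<close>
  have slope_J: "slope d l v i = 0" if "l \<in> J" "i \<in> {1..r}" for l i
  proof -
    have "sgn (affine I l (int_part (X i))) = sgn (affine I l (int_part (Y i)))"
      using same[OF XY(1,2)[OF that(2)]] J that(1) unfolding same_type_def by blast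
    moreover have "nat \<bar>affine I l (int_part (X i))\<bar> = b l" "nat \<bar>affine I l (int_part (Y i))\<bar> = b l"
      using XY(1,2)[OF that(2)] that(1) unfolding P by blast+
    ultimately have "affine I l (int_part (X i)) = affine I l (int_part (Y i))"
      by (metis abs_mult_sgn eq_nat_nat_iff abs_ge_zero)
    then show ?thesis using slope_v[OF that(2), of l] by simp
  qed
  \<comment> \<open>\<open>H l\<close> bounds the change of \<open>l\<close> when every block makes
    at most \<open>k\<close> steps of \<open>M\<close> times its direction. The sum over
    \<open>L\<close> dominates each \<open>H l\<close>, so a single threshold gives one base point
    \<open>x0\<close> for all forms outside \<open>J\<close>.\<close>
  define H where "H l = M * int k * (\<Sum>i\<in>{1..r}. \<bar>slope d l v i\<bar>)" for l
  obtain x0 where x0: "x0 \<in> P"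
    and big: "\<And>l. l \<in> L - J \<Longrightarrow> nat \<bar>affine I l (int_part x0)\<bar> > nat (\<Sum>l\<in>L. H l)"
    using unb by blast
  have H0: "H l \<ge> 0" for l unfolding H_def using M by (simp add: sum_nonneg)
  have int_alt: "(\<forall>i\<in>{1..r}. slope d l v i = 0) \<or>
      M * int k * (\<Sum>i\<in>{1..r}. \<bar>slope d l v i\<bar>) < \<bar>affine (coords r d) l (int_part x0)\<bar>"
    if "l \<in> L" for l
  proof (cases "l \<in> J")
    case False
    have "H l \<le> (\<Sum>l\<in>L. H l)" using H0 fin that by (intro member_le_sum) auto
    then show ?thesis using big[of l] False that unfolding H_def I by auto
  qed (simp add: slope_J)
  \<comment> \<open>A form of \<open>G\<close> that vanishes at \<open>x0\<close> vanishes on all of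
    \<open>P\<close>, since its sign is part of the type; hence it does not change along any
    pair.\<close>
  have slope_G: "slope d g w i = 0" if "g \<in> G" "i \<in> {1..r}" "affine I g (frac_part x0) = 0" for g i
  proof -
    have "sgn (affine I g (frac_part (X i))) = 0" "sgn (affine I g (frac_part (Y i))) = 0"
      using same[OF XY(1)[OF that(2)] x0] same[OF XY(2)[OF that(2)] x0] that(1,3)
      unfolding same_type_def by (metis sgn_0)+
    then show ?thesis using slope_w[OF that(2), of g] by (simp add: sgn_eq_0_iff)
  qed
  \<comment> \<open>The added forms, coordinate minus 1, keep the translated fractional parts below
    1, while the coordinate forms in \<open>G\<close> keep them nonnegative. The added forms are
    negative at \<open>x0\<close>, so only forms of \<open>G\<close> can vanish there.\<close>
  define G' where "G' = G \<union> (\<lambda>c. (\<lambda>c'. if c' = c then 1 else 0, - 1)) ` I"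
  have "\<forall>\<^sub>F \<epsilon> in at_right 0. \<forall>g\<in>G'. affine I g (frac_part x0) \<noteq> 0 \<longrightarrow>
      \<epsilon> * real k * (\<Sum>i\<in>{1..r}. \<bar>slope d g w i\<bar>) < \<bar>affine I g (frac_part x0)\<bar>"
  proof (intro eventually_ball_finite ballI)
    show "finite G'" unfolding G'_def using fin finI by blast
    fix g assume "g \<in> G'"
    \<comment> \<open>The bound on the change tends to 0 with \<open>\<epsilon>\<close>, while a
      form that does not vanish at \<open>x0\<close> has a fixed positive absolute value; finitely
      many such conditions hold together for all small \<open>\<epsilon>\<close>.\<close>
    have lim: "((\<lambda>\<epsilon>. \<epsilon> * real k * (\<Sum>i\<in>{1..r}. \<bar>slope d g w i\<bar>)) \<longlongrightarrow> 0 * real k * (\<Sum>i\<in>{1..r}. \<bar>slope d g w i\<bar>)) (at_right 0)"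
      by (intro tendsto_intros)
    show "\<forall>\<^sub>F \<epsilon> in at_right 0. affine I g (frac_part x0) \<noteq> 0 \<longrightarrow>
      \<epsilon> * real k * (\<Sum>i\<in>{1..r}. \<bar>slope d g w i\<bar>) < \<bar>affine I g (frac_part x0)\<bar>"
    proof (cases "affine I g (frac_part x0) = 0")
      case False
      then have "\<forall>\<^sub>F \<epsilon> in at_right 0. \<epsilon> * real k * (\<Sum>i\<in>{1..r}. \<bar>slope d g w i\<bar>) < \<bar>affine I g (frac_part x0)\<bar>"
        using order_tendstoD(2)[OF lim] by simp
      then show ?thesis by (rule eventually_mono) simp
    qed simp
  qed
  moreover have "\<forall>\<^sub>F \<epsilon> in at_right (0 :: real). 0 < \<epsilon> \<and> \<epsilon> < 1"
    unfolding eventually_at_right_field by (intro exI[of _ 1]) simp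
  ultimately have "\<forall>\<^sub>F \<epsilon> in at_right 0. (\<forall>g\<in>G'. affine I g (frac_part x0) \<noteq> 0 \<longrightarrow>
      \<epsilon> * real k * (\<Sum>i\<in>{1..r}. \<bar>slope d g w i\<bar>) < \<bar>affine I g (frac_part x0)\<bar>) \<and> 0 < \<epsilon> \<and> \<epsilon> < 1"
    by (rule eventually_conj)
  from eventually_happens'[OF trivial_limit_at_right_real this]
  obtain \<epsilon> where eps: "0 < \<epsilon>" "\<epsilon> < 1"
    "\<And>g. g \<in> G' \<Longrightarrow> affine I g (frac_part x0) \<noteq> 0 \<Longrightarrow>
      \<epsilon> * real k * (\<Sum>i\<in>{1..r}. \<bar>slope d g w i\<bar>) < \<bar>affine I g (frac_part x0)\<bar>"
    by blast
  have frac_alt: "(\<forall>i\<in>{1..r}. slope d g w i = 0) \<or>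
      \<epsilon> * real k * (\<Sum>i\<in>{1..r}. \<bar>slope d g w i\<bar>) < \<bar>affine (coords r d) g (frac_part x0)\<bar>"
    if "g \<in> G'" for g
  proof (cases "affine I g (frac_part x0) = 0")
    case True
    have "affine I (\<lambda>c'. if c' = c then 1 else 0, - 1) (frac_part x0) \<noteq> 0" if "c \<in> I" for c
      using frac_lt_1[of "x0 (fst c) ! snd c"]
      by (simp add: affine_coordinate[OF finI that] frac_part_def)
    then have "g \<in> G" using that True unfolding G'_def by blast
    then show ?thesis using slope_G True by blast
  next
    case False
    then show ?thesis using eps(3)[OF that] unfolding I by blast
  qed
  \<comment> \<open>The \<open>t\<close>-th point of side \<open>i\<close> is \<open>x0\<close>
    moved \<open>t\<close> steps in block \<open>i\<close>. The factor \<open>M\<close> preserves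
    the residues of the integer parts.\<close>
  define point where "point i t = map (\<lambda>q. x0 i ! q +
      real t * (real_of_int (M * v (i, q)) + \<epsilon> * w (i, q))) [0..<d i]" for i t
  define B where "B i = point i ` {..<k}" for i
  have "inj_on (point i) {..<k}" if i: "i \<in> {1..r}" for i
  proof -
    have "X i \<in> space r d" "Y i \<in> space r d" using XY(1,2)[OF i] unfolding P by blast+
    then have len: "length (X i i) = d i" "length (Y i i) = d i"
      and ext: "X i \<in> extensional {1..r}" "Y i \<in> extensional {1..r}"
      using i unfolding space_def PiE_iff by blast+
    have "X i i \<noteq> Y i i"
    proof
      assume "X i i = Y i i"
      then have "X i j = Y i j" if "j \<in> {1..r}" for j using XY(3)[OF i that] by (cases "j = i") auto
      then have "X i = Y i" by (intro extensionalityI[OF ext])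
      then show False using XY(4)[OF i] by simp
    qed
    then obtain q where q: "q < d i" "X i i ! q \<noteq> Y i i ! q"
      using len by (metis nth_equalityI)
    have w1: "\<bar>w (i, q)\<bar> < 1"
      using frac_lt_1[of "X i i ! q"] frac_lt_1[of "Y i i ! q"]
        frac_ge_0[of "X i i ! q"] frac_ge_0[of "Y i i ! q"]
      unfolding w_def frac_part_def fst_conv snd_conv by linarith
    \<comment> \<open>The integral part of the step is 0 or at least 1 in absolute value, and the
      fractional part is below 1, so they cannot cancel; if the integral part is 0, the pair differs
      in its fractional parts.\<close>
    have nz: "real_of_int (M * v (i, q)) + \<epsilon> * w (i, q) \<noteq> 0"
    proof (cases "v (i, q) = 0")
      case True
      then have "w (i, q) \<noteq> 0" using q(2)
        unfolding v_def w_def int_part_def frac_part_def frac_def by auto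
      then show ?thesis using True eps(1) by simp
    next
      case False
      have "\<bar>M * v (i, q)\<bar> \<ge> 1" using False M by (simp add: int_one_le_iff_zero_less)
      then have "\<bar>real_of_int (M * v (i, q))\<bar> \<ge> 1" by linarith
      moreover have "\<bar>\<epsilon> * w (i, q)\<bar> < 1"
        unfolding abs_mult using mult_strict_mono[of "\<bar>\<epsilon>\<bar>" 1 "\<bar>w (i, q)\<bar>" 1] eps(1,2) w1 by simp
      ultimately show ?thesis by linarith
    qed
    show ?thesis
    proof (rule inj_onI)
      fix t t' assume "point i t = point i t'"
      then have "point i t ! q = point i t' ! q" by simp
      then show "t = t'" using q(1) nz by (simp add: point_def)
    qed
  qed
  then have "k_grid r d k B"
    unfolding k_grid_def finite_grid_def is_grid_def
    by (auto simp: B_def card_image) (simp add: point_def)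
  moreover have "grid_set r B \<subseteq> P"
  proof
    fix z assume z: "z \<in> grid_set r B"
    then have "\<forall>i\<in>{1..r}. \<exists>t<k. z i = point i t" unfolding grid_set_def PiE_iff B_def by blast
    then obtain t where t: "\<And>i. i \<in> {1..r} \<Longrightarrow> t i < k" "\<And>i. i \<in> {1..r} \<Longrightarrow> z i = point i (t i)"
      by metis
    have zsp: "z \<in> space r d"
      using z t(2) unfolding grid_set_def space_def PiE_iff by (simp add: point_def)
    define n where "n c = int_part x0 c + (M * int (t (fst c))) * v c" for c
    define u where "u c = frac_part x0 c + (\<epsilon> * real (t (fst c))) * w c" for c
    have sgn_n: "sgn (affine I l n) = sgn (affine I l (int_part x0))" if "l \<in> L" for l
      unfolding n_def[abs_def] I
    proof (rule sgn_affine_shift_blocks[OF _ int_alt[OF that]])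
      fix i assume "i \<in> {1..r}"
      then show "\<bar>M * int (t i)\<bar> \<le> M * int k" using t(1)[of i] M by (simp add: abs_mult)
    qed
    have sgn_u: "sgn (affine I g u) = sgn (affine I g (frac_part x0))" if "g \<in> G'" for g
      unfolding u_def[abs_def] I
    proof (rule sgn_affine_shift_blocks[OF _ frac_alt[OF that]])
      fix i assume "i \<in> {1..r}"
      then show "\<bar>\<epsilon> * real (t i)\<bar> \<le> \<epsilon> * real k" using t(1)[of i] eps(1) by (simp add: abs_mult)
    qed
    \<comment> \<open>The signs of \<open>u c\<close> and \<open>u c - 1\<close> are those at
      \<open>x0\<close>, so \<open>u c\<close> lies in [0,1). No carry occurs, and
      \<open>n c\<close> and \<open>u c\<close> are the true integer and fractional parts of
      \<open>z\<close>.\<close>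
    have coord: "int_part z c = n c" "frac_part z c = u c" if c: "c \<in> I" for c
    proof -
      have "(\<lambda>c'. if c' = c then 1 else 0, 0) \<in> G'" "(\<lambda>c'. if c' = c then 1 else 0, - 1) \<in> G'"
        using G[OF c] c unfolding G'_def by blast+
      from sgn_u[OF this(1)] sgn_u[OF this(2)]
      have "sgn (u c) = sgn (frac_part x0 c)" "sgn (u c - 1) = sgn (frac_part x0 c - 1)"
        by (simp_all add: affine_coordinate[OF finI c])
      moreover have "frac_part x0 c \<ge> 0" "frac_part x0 c < 1"
        unfolding frac_part_def by (simp_all add: frac_lt_1)
      ultimately have u01: "u c \<ge> 0" "u c < 1" by (auto simp: sgn_if split: if_splits)
      have "fst c \<in> {1..r}" "snd c < d (fst c)" using c unfolding I coords_def by auto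
      then have "z (fst c) ! snd c = of_int (n c) + u c"
        unfolding t(2)[OF \<open>fst c \<in> {1..r}\<close>] n_def u_def
        by (simp add: point_def int_part_def frac_part_def frac_def algebra_simps)
      then show "int_part z c = n c" "frac_part z c = u c"
        using u01 unfolding int_part_def frac_part_def
        by (simp_all add: frac_unique_iff floor_unique)
    qed
    have aff: "affine I l (int_part z) = affine I l n" "affine I g (frac_part z) = affine I g u" for l g
      using coord by (simp_all add: affine_def)
    have "same_type I L M G x0 z"
      unfolding same_type_def aff using sgn_n sgn_u coord(1)
      by (auto simp: G'_def n_def mult.assoc)
    then have "same_type I L M G s z" using x0 unfolding P by (blast intro: same_type_trans)
    moreover have "nat \<bar>affine I l (int_part z)\<bar> = b l" if "l \<in> J" for l
    proof -
      have "affine I l n = affine I l (int_part x0)"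
        using affine_shift_blocks[of r d l "int_part x0" "\<lambda>i. M * int (t i)" v] slope_J[OF that]
        unfolding n_def[abs_def] I by simp
      then show ?thesis unfolding aff using x0 that unfolding P by simp
    qed
    ultimately show "z \<in> P" unfolding P using zsp by blast
  qed
  ultimately show ?thesis by blast
qed

text \<open>A type is an element of a finite product: three signs for each form and \<open>M\<close>
  residues for each coordinate.\<close>

lemma finite_type_classes:
  assumes "finite I" "finite L" "finite G" "M > 0"
  shows "finite (range (\<lambda>s. {x\<in>S. same_type I L M G s x}))"
proof -
  \<comment> \<open>Restricting the three functions makes equality of \<open>sg\<close> coincide
    with \<open>same_type\<close>.\<close>
  define sg where "sg x = (restrict (\<lambda>l. sgn (affine I l (int_part x))) L,
      restrict (\<lambda>c. int_part x c mod M) I, restrict (\<lambda>g. sgn (affine I g (frac_part x))) G)" for x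
  let ?T = "PiE L (\<lambda>_. {- 1, 0, 1 :: int}) \<times> PiE I (\<lambda>_. {0..<M}) \<times> PiE G (\<lambda>_. {- 1, 0, 1 :: real})"
  have eq: "same_type I L M G s x \<longleftrightarrow> sg s = sg x" for s x
    unfolding same_type_def sg_def
    by (simp add: fun_eq_iff restrict_def Ball_def)
  have "sg s \<in> ?T" for s
    using assms(4) by (auto simp: sg_def sgn_if)
  then have "range (\<lambda>s. {x\<in>S. same_type I L M G s x}) \<subseteq> (\<lambda>\<tau>. {x\<in>S. \<tau> = sg x}) ` ?T"
    unfolding eq by blast
  moreover have "finite ?T" using assms by (intro finite_cartesian_product finite_PiE) auto
  ultimately show ?thesis by (rule finite_surj[rotated])
qed

text \<open>The split runs over the absolute values of the forms in \<open>L\<close>, because the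
  type already fixes their signs. On each resulting piece some block is determined by the others;
  otherwise the piece, and with it \<open>X\<close>, would contain a \<open>k\<close>-grid.\<close>

lemma grid_bounded_type_class:
  assumes I: "I = coords r d" and fin: "finite L" "finite G" and M: "M > 0"
    and G: "\<And>c. c \<in> I \<Longrightarrow> (\<lambda>c'. if c' = c then 1 else 0, 0) \<in> G"
    and free: "k_free r d k X" and sub: "{x\<in>space r d. same_type I L M G s x} \<subseteq> X"
  shows "grid_bounded r d {x\<in>space r d. same_type I L M G s x}"
proof (rule constant_or_unbounded_split[where L = L
      and f = "\<lambda>l x. nat \<bar>affine I l (int_part x)\<bar>" and Q = "grid_bounded r d"])
  fix J b P
  assume J: "J \<subseteq> L"
    and P: "P = {x \<in> {x\<in>space r d. same_type I L M G s x}.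
        \<forall>l\<in>J. nat \<bar>affine I l (int_part x)\<bar> = b l}"
    and unb: "\<And>K. \<exists>x\<in>P. \<forall>l\<in>L - J. nat \<bar>affine I l (int_part x)\<bar> > K"
  have "\<exists>i\<in>{1..r}. \<forall>x\<in>P. \<forall>y\<in>P. (\<forall>j\<in>{1..r} - {i}. x j = y j) \<longrightarrow> x = y"
  proof (rule ccontr)
    assume "\<not> ?thesis"
    then have fibres: "\<exists>x\<in>P. \<exists>y\<in>P. (\<forall>j\<in>{1..r} - {i}. x j = y j) \<and> x \<noteq> y" if "i \<in> {1..r}" for i
      using that by blast
    have "P = {x\<in>space r d. same_type I L M G s x \<and>
        (\<forall>l\<in>J. nat \<bar>affine I l (int_part x)\<bar> = b l)}"
      unfolding P by simp
    from grid_in_type_class[OF I fin M G J this unb fibres]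
    obtain B where "k_grid r d k B" "grid_set r B \<subseteq> P" by blast
    moreover have "P \<subseteq> X" using sub unfolding P by blast
    ultimately show False using free unfolding k_free_def by blast
  qed
  then obtain i where "i \<in> {1..r}"
    "\<And>x y. x \<in> P \<Longrightarrow> y \<in> P \<Longrightarrow> \<forall>j\<in>{1..r} - {i}. x j = y j \<Longrightarrow> x = y"
    by blast
  then show "grid_bounded r d P" by (rule grid_bounded_if_block_determined)
qed (simp_all add: fin grid_bounded_empty grid_bounded_Un)

lemma grid_bounded_type_determined:
  assumes det: "type_determined (coords r d) h" and free: "k_free r d k {x\<in>space r d. h x}"
  shows "grid_bounded r d {x\<in>space r d. h x}"
proof -
  let ?I = "coords r d" and ?X = "{x\<in>space r d. h x}"
  obtain L M G where LMG: "finite L" "M > 0" "finite G"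
    "\<And>x y. same_type ?I L M G x y \<Longrightarrow> h x = h y"
    using det unfolding type_determined_def by blast
  \<comment> \<open>The coordinate forms are added because the grid construction relies on them to
    keep fractional parts nonnegative; a finer type still determines \<open>h\<close>.\<close>
  define G' where "G' = G \<union> (\<lambda>c. (\<lambda>c'. if c' = c then 1 else 0, 0)) ` ?I"
  let ?cl = "\<lambda>s. {x\<in>space r d. same_type ?I L M G' s x}"
  have finG: "finite G'" unfolding G'_def using LMG(3) finite_coords by blast
  have sub: "?cl s \<subseteq> ?X" if "s \<in> ?X" for s
  proof
    fix x assume x: "x \<in> ?cl s"
    then have "same_type ?I L M G s x" using same_type_mono[of ?I L M G' s x L M G]
      unfolding G'_def by simp
    from LMG(4)[OF this] show "x \<in> ?X" using x that by simp
  qed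
  have "grid_bounded r d (\<Union>(?cl ` ?X))"
  proof (rule grid_bounded_Union)
    show "finite (?cl ` ?X)"
      by (rule finite_subset[OF _ finite_type_classes[OF finite_coords LMG(1) finG LMG(2)]]) blast
    fix S assume "S \<in> ?cl ` ?X"
    then obtain s where s: "s \<in> ?X" "S = ?cl s" by blast
    show "grid_bounded r d S" unfolding s(2)
      by (rule grid_bounded_type_class[OF refl LMG(1) finG LMG(2) _ free sub[OF s(1)]])
        (simp add: G'_def)
  qed
  moreover have "\<Union>(?cl ` ?X) = ?X"
  proof
    show "\<Union>(?cl ` ?X) \<subseteq> ?X" using sub by (rule UN_least)
    show "?X \<subseteq> \<Union>(?cl ` ?X)"
    proof
      fix x assume "x \<in> ?X"
      then show "x \<in> \<Union>(?cl ` ?X)" by (intro UN_I[of x]) (simp_all add: same_type_refl)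
    qed
  qed
  ultimately show ?thesis by simp
qed

section \<open>Quantifier elimination\<close>

lemma piecewise_affine_minus:
  assumes "piecewise_affine I f"
  shows "piecewise_affine I (\<lambda>x. - f x)"
  using piecewise_affine_cmult[OF assms, of "- 1"] by simp

lemma piecewise_affine_Inum:
  assumes "\<And>n. piecewise_affine I (\<lambda>x. bs x ! n)"
  shows "piecewise_affine I (\<lambda>x. Inum (bs x) t)"
proof (induction t)
  case (C k)
  show ?case by (simp add: piecewise_affine_const)
next
  case (Bound n)
  show ?case by (simp add: assms)
next
  case (CN n k t)
  then show ?case using piecewise_affine_add[OF piecewise_affine_cmult[OF assms]] by simp
next
  case (Neg t)
  then show ?case using piecewise_affine_minus by simp
next
  case (Add s t)
  then show ?case using piecewise_affine_add by simp
next
  case (Sub s t)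
  then show ?case using piecewise_affine_add[OF Sub(1) piecewise_affine_minus[OF Sub(2)]] by simp
next
  case (Mul k t)
  then show ?case using piecewise_affine_cmult by simp
next
  case (Floor t)
  then show ?case using piecewise_affine_floor by simp
next
  case (CF k s t)
  then show ?case
    using piecewise_affine_add[OF piecewise_affine_cmult[OF piecewise_affine_floor[OF CF(1)]] CF(2)]
    by simp
qed

lemma type_determined_Ifm:
  assumes "\<And>n. piecewise_affine I (\<lambda>x. bs x ! n)" and "qfree p"
  shows "type_determined I (\<lambda>x. Ifm (bs x) p)"
proof -
  note sgn = type_determined_sgn[OF piecewise_affine_Inum[OF assms(1)]]
  note dvd = type_determined_rdvd[OF piecewise_affine_Inum[OF assms(1)]]
  have neg: "y < 0 \<longleftrightarrow> sgn y = -1" and pos: "y > 0 \<longleftrightarrow> sgn y = 1"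
    and le: "y \<le> 0 \<longleftrightarrow> \<not> sgn y = 1" and ge: "y \<ge> 0 \<longleftrightarrow> \<not> sgn y = -1" for y :: real
    by (auto simp: sgn_if)
  show ?thesis
    using assms(2)
  proof (induction p)
    case (Lt t) then show ?case using sgn[of t "- 1"] by (simp add: neg)
  next
    case (Gt t) then show ?case using sgn[of t 1] by (simp add: pos)
  next
    case (Le t) then show ?case using type_determined_not[OF sgn[of t 1]] by (simp add: le)
  next
    case (Ge t) then show ?case using type_determined_not[OF sgn[of t "- 1"]] by (simp add: ge)
  next
    case (Eq t) then show ?case using sgn[of t 0] by (simp add: sgn_eq_0_iff)
  next
    case (NEq t) then show ?case using type_determined_not[OF sgn[of t 0]] by (simp add: sgn_eq_0_iff)
  next
    case (Dvd i t) then show ?case using dvd[of i t] by simp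
  next
    case (NDvd i t) then show ?case using type_determined_not[OF dvd[of i t]] by simp
  next
    case (Not p) then show ?case using type_determined_not by simp
  next
    case (And p q) then show ?case using type_determined_binop[of I _ _ "(\<and>)"] by simp
  next
    case (Or p q) then show ?case using type_determined_binop[of I _ _ "(\<or>)"] by simp
  next
    case (Imp p q) then show ?case using type_determined_binop[of I _ _ "(\<longrightarrow>)"] by simp
  next
    case (Iff p q) then show ?case using type_determined_binop[of I _ _ "(=)"] by simp
  qed (auto intro: type_determined_const)
qed

text \<open>The formulas of \<^theory>\<open>HOL-Decision_Procs.MIR\<close> use de Bruijn indices and have integer constants
  only, so real parameters become additional free variables: \<open>vi\<close> and \<open>ci\<close> give the index of a
  variable and of a parameter.\<close>

primrec mir_tm :: "(nat \<Rightarrow> nat) \<Rightarrow> (real \<Rightarrow> nat) \<Rightarrow> tm \<Rightarrow> num" where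
  "mir_tm vi ci (Var n) = Bound (vi n)"
| "mir_tm vi ci (Const c) = Bound (ci c)"
| "mir_tm vi ci (Defs.Add s t) = MIR.Add (mir_tm vi ci s) (mir_tm vi ci t)"

primrec mir_fm :: "(nat \<Rightarrow> nat) \<Rightarrow> (real \<Rightarrow> nat) \<Rightarrow> Defs.fm \<Rightarrow> MIR.fm" where
  "mir_fm vi ci (Less s t) = Lt (Sub (mir_tm vi ci s) (mir_tm vi ci t))"
| "mir_fm vi ci (Defs.Eq s t) = MIR.Eq (Sub (mir_tm vi ci s) (mir_tm vi ci t))"
| "mir_fm vi ci (IsInt t) = Dvd 1 (mir_tm vi ci t)"
| "mir_fm vi ci (Defs.Neg p) = Not (mir_fm vi ci p)"
| "mir_fm vi ci (Conj p q) = And (mir_fm vi ci p) (mir_fm vi ci q)"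
| "mir_fm vi ci (Exi n p) = E (mir_fm ((Suc \<circ> vi)(n := 0)) (Suc \<circ> ci) p)"

text \<open>A list has finitely many entries while an assignment is total, so agreement is required
  only for the variables below \<open>m\<close> and the parameters in \<open>S\<close>.\<close>

definition represents :: "nat \<Rightarrow> real set \<Rightarrow> (nat \<Rightarrow> nat) \<Rightarrow> (real \<Rightarrow> nat) \<Rightarrow> real list \<Rightarrow> (nat \<Rightarrow> real) \<Rightarrow> bool" where
  "represents m S vi ci bs e \<longleftrightarrow> (\<forall>n<m. bs ! vi n = e n) \<and> (\<forall>c\<in>S. bs ! ci c = c)"

lemma represents_max_Un:
  "represents (max m m') (S \<union> S') vi ci bs e \<longleftrightarrow>
    represents m S vi ci bs e \<and> represents m' S' vi ci bs e"
  unfolding represents_def Ball_def by (auto simp: less_max_iff_disj)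

lemma represents_update:
  "represents m S vi ci bs e \<Longrightarrow>
    represents m S ((Suc \<circ> vi)(n := 0)) (Suc \<circ> ci) (a # bs) (e(n := a))"
  by (simp add: represents_def)

lemma Inum_mir_tm:
  "\<exists>m S. finite S \<and> (\<forall>vi ci bs e. represents m S vi ci bs e \<longrightarrow> Inum bs (mir_tm vi ci t) = tval e t)"
proof (induction t)
  case (Var n)
  show ?case by (intro exI[of _ "Suc n"] exI[of _ "{}"]) (simp add: represents_def)
next
  case (Const c)
  show ?case by (intro exI[of _ 0] exI[of _ "{c}"]) (simp add: represents_def)
next
  case (Add s t)
  then obtain m S m' S' where "finite S" "finite S'"
    "\<And>vi ci bs e. represents m S vi ci bs e \<Longrightarrow> Inum bs (mir_tm vi ci s) = tval e s"
    "\<And>vi ci bs e. represents m' S' vi ci bs e \<Longrightarrow> Inum bs (mir_tm vi ci t) = tval e t"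
    by blast
  then show ?case
    by (intro exI[of _ "max m m'"] exI[of _ "S \<union> S'"]) (auto simp: represents_max_Un)
qed

text \<open>\<open>m\<close> and \<open>S\<close> depend on the formula alone. Uniformity in
  \<open>vi\<close> and \<open>ci\<close> lets the induction hypothesis be applied to the shifted
  index maps under a quantifier.\<close>

lemma Ifm_mir_fm:
  "\<exists>m S. finite S \<and> (\<forall>vi ci bs e. represents m S vi ci bs e \<longrightarrow> Ifm bs (mir_fm vi ci p) = sat e p)"
proof -
  have atom: "\<exists>m S. finite S \<and> (\<forall>vi ci bs e. represents m S vi ci bs e \<longrightarrow>
      Inum bs (mir_tm vi ci s) = tval e s \<and> Inum bs (mir_tm vi ci t) = tval e t)" for s t
  proof -
    obtain m S m' S' where "finite S" "finite S'"
      "\<And>vi ci bs e. represents m S vi ci bs e \<Longrightarrow> Inum bs (mir_tm vi ci s) = tval e s"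
      "\<And>vi ci bs e. represents m' S' vi ci bs e \<Longrightarrow> Inum bs (mir_tm vi ci t) = tval e t"
      using Inum_mir_tm[of s] Inum_mir_tm[of t] by blast
    then show ?thesis
      by (intro exI[of _ "max m m'"] exI[of _ "S \<union> S'"])
        (auto simp: represents_max_Un)
  qed
  show ?thesis
  proof (induction p)
    case (Less s t)
    obtain m S where "finite S" "\<And>vi ci bs e. represents m S vi ci bs e \<Longrightarrow>
      Inum bs (mir_tm vi ci s) = tval e s \<and> Inum bs (mir_tm vi ci t) = tval e t"
      using atom[of s t] by blast
    then show ?case by (intro exI[of _ m] exI[of _ S]) simp
  next
    case (Eq s t)
    obtain m S where "finite S" "\<And>vi ci bs e. represents m S vi ci bs e \<Longrightarrow>
      Inum bs (mir_tm vi ci s) = tval e s \<and> Inum bs (mir_tm vi ci t) = tval e t"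
      using atom[of s t] by blast
    then show ?case by (intro exI[of _ m] exI[of _ S]) simp
  next
    case (IsInt t)
    obtain m S where mS: "finite S" "\<And>vi ci bs e. represents m S vi ci bs e \<Longrightarrow>
      Inum bs (mir_tm vi ci t) = tval e t"
      using atom[of t t] by blast
    have "1 rdvd y \<longleftrightarrow> y \<in> \<int>" for y :: real
      unfolding rdvd_def by (auto elim: Ints_cases)
    then show ?case using mS by (intro exI[of _ m] exI[of _ S]) simp
  next
    case (Neg p)
    then show ?case by auto
  next
    case (Conj p q)
    then obtain m S m' S' where "finite S" "finite S'"
      "\<And>vi ci bs e. represents m S vi ci bs e \<Longrightarrow> Ifm bs (mir_fm vi ci p) = sat e p"
      "\<And>vi ci bs e. represents m' S' vi ci bs e \<Longrightarrow> Ifm bs (mir_fm vi ci q) = sat e q"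
      by blast
    then show ?case
      by (intro exI[of _ "max m m'"] exI[of _ "S \<union> S'"])
        (auto simp: represents_max_Un)
  next
    case (Exi n p)
    then obtain m S where mS: "finite S"
      "\<And>vi ci bs e. represents m S vi ci bs e \<Longrightarrow> Ifm bs (mir_fm vi ci p) = sat e p"
      by blast
    have "Ifm bs (mir_fm vi ci (Exi n p)) = sat e (Exi n p)" if "represents m S vi ci bs e" for vi ci bs e
      using mS(2)[OF represents_update[OF that]] by simp
    then show ?case using mS(1) by blast
  qed
qed

section \<open>Definable sets as type-determined sets\<close>

lemma length_flat:
  assumes "\<forall>i\<in>{1..r}. length (x i) = d i"
  shows "length (flat r x) = total_dim r d"
proof -
  have "length (flat r x) = (\<Sum>i\<in>{1..r}. length (x i))"
    by (induction r) (simp_all add: flat_def)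
  then show ?thesis using assms by (simp add: total_dim_def)
qed

text \<open>The coordinate \<open>c\<close> is chosen before \<open>x\<close>, so an entry of the
  flattened point is a fixed coordinate function and hence piecewise affine.\<close>

lemma flat_coordinate:
  assumes "j < total_dim r d"
  shows "\<exists>c\<in>coords r d. \<forall>x. (\<forall>i\<in>{1..r}. length (x i) = d i) \<longrightarrow> flat r x ! j = x (fst c) ! snd c"
  using assms
proof (induction r)
  case 0
  then show ?case by (simp add: total_dim_def)
next
  case (Suc r)
  have flat_Suc: "flat (Suc r) x = flat r x @ x (Suc r)" for x by (simp add: flat_def)
  have len: "length (flat r x) = total_dim r d" if "\<forall>i\<in>{1..Suc r}. length (x i) = d i" for x
    using that by (intro length_flat) simp
  show ?case
  proof (cases "j < total_dim r d")
    case True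
    then obtain c where c: "c \<in> coords r d"
      "\<And>x. \<forall>i\<in>{1..r}. length (x i) = d i \<Longrightarrow> flat r x ! j = x (fst c) ! snd c"
      using Suc.IH by blast
    have "c \<in> coords (Suc r) d" using c(1) by (auto simp: coords_def)
    moreover have "flat (Suc r) x ! j = x (fst c) ! snd c"
      if "\<forall>i\<in>{1..Suc r}. length (x i) = d i" for x
      using c(2)[of x] len[OF that] that True by (simp add: flat_Suc nth_append)
    ultimately show ?thesis by blast
  next
    case False
    let ?c = "(Suc r, j - total_dim r d)"
    have "?c \<in> coords (Suc r) d" using Suc.prems False by (auto simp: coords_def total_dim_def)
    moreover have "flat (Suc r) x ! j = x (fst ?c) ! snd ?c"
      if "\<forall>i\<in>{1..Suc r}. length (x i) = d i" for x
      using len[OF that] False by (simp add: flat_Suc nth_append)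
    ultimately show ?thesis by blast
  qed
qed

lemma definable_type_determined:
  assumes "definable r d X"
  shows "\<exists>h. type_determined (coords r d) h \<and> X = {x\<in>space r d. h x}"
proof -
  obtain f where X: "X = {x\<in>space r d. sat (\<lambda>j. if j < total_dim r d then flat r x ! j else 0) f}"
    using assms unfolding definable_def by blast
  obtain m S where mS: "finite S"
    "\<And>vi ci bs e. represents m S vi ci bs e \<Longrightarrow> Ifm bs (mir_fm vi ci f) = sat e f"
    using Ifm_mir_fm[of f] by blast
  obtain cs where cs: "set cs = S" using finite_list[OF mS(1)] by blast
  have "\<forall>c\<in>S. \<exists>n<length cs. cs ! n = c" using cs by (metis in_set_conv_nth)
  then obtain pos where pos: "\<And>c. c \<in> S \<Longrightarrow> pos c < length cs \<and> cs ! pos c = c" by metis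
  have "\<forall>j. \<exists>c. j < total_dim r d \<longrightarrow> c \<in> coords r d \<and>
      (\<forall>x. (\<forall>i\<in>{1..r}. length (x i) = d i) \<longrightarrow> flat r x ! j = x (fst c) ! snd c)"
    using flat_coordinate by blast
  then obtain c where c: "\<And>j. j < total_dim r d \<Longrightarrow> c j \<in> coords r d"
    "\<And>j x. j < total_dim r d \<Longrightarrow> \<forall>i\<in>{1..r}. length (x i) = d i \<Longrightarrow>
      flat r x ! j = x (fst (c j)) ! snd (c j)"
    by metis
  \<comment> \<open>The first \<open>m\<close> entries are the variables, with the default 0 from
    \<open>total_dim r d\<close> on as in \<open>definable\<close>; the parameters follow, which
    explains the index \<open>m + pos c\<close>.\<close>
  define bs where "bs x = map (\<lambda>j. if j < total_dim r d then x (fst (c j)) ! snd (c j) else 0) [0..<m] @ cs" for x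
  define p where "p = mircfrqe (mir_fm id (\<lambda>c. m + pos c) f)"
  have "piecewise_affine (coords r d) (\<lambda>x. bs x ! n)" for n
  proof -
    consider "n < m" "n < total_dim r d" | "n < m" "\<not> n < total_dim r d" | "m \<le> n" by linarith
    then show ?thesis
    proof cases
      case 1
      then show ?thesis using piecewise_affine_coordinate[OF finite_coords c(1)]
        by (simp add: bs_def nth_append)
    next
      case 2
      then show ?thesis by (simp add: bs_def nth_append piecewise_affine_const)
    next
      case 3
      \<comment> \<open>This includes positions past the end of the list: their value is unspecified
        but does not depend on \<open>x\<close>.\<close>
      then have "bs x ! n = cs ! (n - m)" for x by (simp add: bs_def nth_append)
      then show ?thesis by (simp add: piecewise_affine_const)
    qed
  qed
  then have "type_determined (coords r d) (\<lambda>x. Ifm (bs x) p)"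
    by (rule type_determined_Ifm) (simp add: p_def mircfrqe)
  moreover have "Ifm (bs x) p \<longleftrightarrow> sat (\<lambda>j. if j < total_dim r d then flat r x ! j else 0) f"
    if "x \<in> space r d" for x
  proof -
    have "represents m S id (\<lambda>c. m + pos c) (bs x) (\<lambda>j. if j < total_dim r d then flat r x ! j else 0)"
      using that c(2)[of _ x] pos by (auto simp: represents_def bs_def nth_append space_def PiE_iff)
    from mS(2)[OF this] show ?thesis by (simp add: p_def mircfrqe)
  qed
  ultimately show ?thesis unfolding X by blast
qed

theorem theorem5p21:
  fixes r :: nat and d :: "nat \<Rightarrow> nat" and X :: "(nat \<Rightarrow> real list) set"
  assumes "r \<ge> 1" and "\<forall>i\<in>{1..r}. d i \<ge> 1"
    and "definable r d X"
  shows "Zar r d X"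
proof (cases "\<exists>k\<ge>1. k_free r d k X")
  case True
  then obtain k where k: "k_free r d k X" by blast
  obtain h where h: "type_determined (coords r d) h" "X = {x\<in>space r d. h x}"
    using definable_type_determined[OF assms(3)] by blast
  have "grid_bounded r d X"
    using grid_bounded_type_determined[OF h(1)] k unfolding h(2) by blast
  then obtain a where a: "a \<ge> 0"
    "\<And>B. finite_grid r d B \<Longrightarrow> real (card (X \<inter> grid_set r B)) \<le> a * real (delta r B)"
    unfolding grid_bounded_def by blast
  \<comment> \<open>\<open>Zar\<close> asks for a positive constant, while \<open>a\<close> may be
    0.\<close>
  have "real (card (X \<inter> grid_set r B)) \<le> (a + 1) * real (delta r B)" if "finite_grid r d B" for B
    using a(2)[OF that] by (simp add: distrib_right)
  then show ?thesis unfolding Zar_def using a(1) by (intro exI[of _ "a + 1"]) simp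
next
  case False
  then show ?thesis unfolding Zar_def using zero_less_one by blast
qed

end
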